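(* Let $(b_{n,k})$ be a structure $\mathbf{B}$ on the interval $X$ with covariance characteristic $b(x)$, and let $(h_{n,k})$ be a structure $\mathbf{H}$ on the interval $T$ with quadratic covariance characteristic $h(t)=at^2+bt+c$, where $a,b,c$ are real constants (the constant $b$ is not to be confused with the function $b(x)$). Let $n\in\mathbb N$, $n>3a$, be such that $h_{n,k}$ is defined for every $k$ with $b_{n,k}\not\equiv0$, and put $$P_n(f,x)=\sum_{k=0}^\infty b_{n,k}(x)\int_{-\infty}^{\infty} f(t)h_{n,k}(t)\,dt .$$ Let $\omega$ be a modulus of continuity and $f\in H^{\omega}$. Then for all $x\in X$ $$|P_n(f,x)-f(x)|\le \omega\!\left(\tfrac{1}{\sqrt n}\right)\left(1+\frac{n}{n-3a}\left(a\left(\frac{nx+b}{n-2a}\right)^2+b\,\frac{nx+b}{n-2a}+c+b(x)\frac{n}{n-2a}\right)\right)+\omega\!\left(\left|\frac{2ax+b}{n-2a}\right|\right).$$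
   Context: $\mathbb N=\{1,2,\dots\}$. Modulus of continuity: a continuous nondecreasing subadditive function $\omega:[0,\infty)\to[0,\infty)$ with $\omega(0)=0$. $H^\omega$ is the class of functions $f:\mathbb R\to\mathbb R$ with $|f(s)-f(t)|\le\omega(|s-t|)$ for all $s,t$. Structure $\mathbf B$: let $X\subset\mathbb R$ be a nondegenerate interval and $b:X\to[0,\infty)$. A structure $\mathbf B$ with covariance characteristic $b$ is a family of differentiable functions $b_{n,k}:X\to[0,1]$, $n\in\mathbb N$, $k=0,1,2,\dots$ (one-sided derivatives at endpoints belonging to $X$), with $\sum_{k=0}^\infty b_{n,k}(x)=1$ for all $n$, $x$, satisfying $b(x)\,b_{n,k}'(x)=(k-nx)\,b_{n,k}(x)$ for all $x\in X$. All moments of the distribution $P\{\xi=k\}=b_{n,k}(x)$ are assumed finite. Structure $\mathbf H$: let $T\subset\mathbb R$ be an open interval (possibly unbounded) and $h:T\to(0,\infty)$; here $h$ is a polynomial which is positive on $T$ and vanishes at the finite endpoints of $T$. A structure $\mathbf H$ with covariance characteristic $h$ is a family of probability densities $h_{n,k}$ on $\mathbb R$ (for $n\in\mathbb N$ and nonnegative integers $k$ in the range for which the structure is defined) that are zero outside the closure of $T$, differentiable on $T$, and satisfy $h(t)\,h_{n,k}'(t)=(k-nt)\,h_{n,k}(t)$ for $t\in T$. *)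

theory Defs
  imports "HOL-Probability.Probability" "HOL-Computational_Algebra.Polynomial"
begin

text \<open>Functions on an interval are total functions \<^typ>\<open>real \<Rightarrow> real\<close>; only their values on that
  interval are constrained or used.\<close>

definition modulus_of_continuity :: "(real \<Rightarrow> real) \<Rightarrow> bool" where
  "modulus_of_continuity \<omega> \<longleftrightarrow>
     continuous_on {0..} \<omega> \<and> mono_on {0..} \<omega> \<and>
     (\<forall>s\<ge>0. \<forall>t\<ge>0. \<omega> (s + t) \<le> \<omega> s + \<omega> t) \<and>
     (\<forall>t\<ge>0. 0 \<le> \<omega> t) \<and> \<omega> 0 = 0"

definition H_class :: "(real \<Rightarrow> real) \<Rightarrow> (real \<Rightarrow> real) set" where
  "H_class \<omega> = {f. \<forall>s t. \<bar>f s - f t\<bar> \<le> \<omega> \<bar>s - t\<bar>}"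

text \<open>The derivative is taken within \<open>X\<close>, which gives the one-sided derivative at an endpoint
  belonging to \<open>X\<close>. It is unique because \<open>X\<close> is nondegenerate.\<close>

definition structure_B ::
  "real set \<Rightarrow> (real \<Rightarrow> real) \<Rightarrow> (nat \<Rightarrow> nat \<Rightarrow> real \<Rightarrow> real) \<Rightarrow> bool" where
  "structure_B X \<beta> B \<longleftrightarrow>
     is_interval X \<and> (\<exists>u\<in>X. \<exists>v\<in>X. u < v) \<and>
     (\<forall>x\<in>X. 0 \<le> \<beta> x) \<and>
     (\<forall>n\<ge>1. \<forall>x\<in>X.
        (\<forall>k. 0 \<le> B n k x \<and> B n k x \<le> 1) \<and>
        (\<lambda>k. B n k x) sums 1 \<and>
        (\<forall>m. summable (\<lambda>k. real k ^ m * B n k x)) \<and>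
        (\<forall>k. \<exists>D. (B n k has_real_derivative D) (at x within X) \<and>
                 \<beta> x * D = (real k - real n * x) * B n k x))"

definition probability_density :: "(real \<Rightarrow> real) \<Rightarrow> bool" where
  "probability_density p \<longleftrightarrow>
     p \<in> borel_measurable borel \<and> (\<forall>t. 0 \<le> p t) \<and>
     prob_space (density lborel (\<lambda>t. ennreal (p t)))"

text \<open>\<open>K n\<close> is the set of those \<open>k\<close> for which the density \<open>H n k\<close> is defined. The frontier of the
  nonempty open interval \<open>T\<close> consists of its finite endpoints.\<close>

definition structure_H ::
  "real set \<Rightarrow> real poly \<Rightarrow> (nat \<Rightarrow> nat set) \<Rightarrow> (nat \<Rightarrow> nat \<Rightarrow> real \<Rightarrow> real) \<Rightarrow> bool" where
  "structure_H T h K H \<longleftrightarrow>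
     is_interval T \<and> open T \<and> T \<noteq> {} \<and>
     (\<forall>t\<in>T. 0 < poly h t) \<and> (\<forall>t\<in>frontier T. poly h t = 0) \<and>
     (\<forall>n\<ge>1. \<forall>k\<in>K n.
        probability_density (H n k) \<and>
        (\<forall>t. t \<notin> closure T \<longrightarrow> H n k t = 0) \<and>
        (\<forall>t\<in>T. \<exists>D. (H n k has_real_derivative D) (at t) \<and>
                 poly h t * D = (real k - real n * t) * H n k t))"

definition P_op ::
  "(nat \<Rightarrow> nat \<Rightarrow> real \<Rightarrow> real) \<Rightarrow> (nat \<Rightarrow> nat \<Rightarrow> real \<Rightarrow> real) \<Rightarrow> nat \<Rightarrow> (real \<Rightarrow> real) \<Rightarrow> real \<Rightarrow> real"
  where "P_op B H n f x = (\<Sum>k. B n k x * (LINT t|lborel. f t * H n k t))"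

end

theory Submission
  imports Defs
begin

text \<open>Integrating the derivatives of \<open>h p\<close> and \<open>t h p\<close> over \<open>T\<close> for \<open>p = H n k\<close> shows that \<open>p\<close> has mean
  \<open>m = (k + b) / (n - 2 a)\<close> and variance \<open>h m / (n - 3 a)\<close>. Differentiating \<open>\<Sum>k. B n k x = 1\<close> and
  \<open>\<Sum>k. k * B n k x = n * x\<close> term by term shows that the discrete distribution has mean \<open>n x\<close> and variance at
  most \<open>n \<beta> x\<close>. Hence the mixture has mean \<open>y = (n x + b) / (n - 2 a)\<close> and an explicitly bounded
  variance, and the estimate follows from \<open>\<omega> t \<le> \<omega> \<delta> * (1 + (t / \<delta>)\<^sup>2)\<close> with \<open>\<delta> = 1 / sqrt n\<close>, applied
  around \<open>y\<close>, together with \<open>\<bar>f y - f x\<bar> \<le> \<omega> \<bar>y - x\<bar>\<close>.\<close>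

section \<open>Moments of Pearson densities\<close>

text \<open>Monotone convergence along the intervals \<open>{u..u + real i}\<close>. It turns a
  bound obtained from an antiderivative into integrability of a tail.\<close>

lemma integrable_atLeast_if_bounded:
  fixes f :: "real \<Rightarrow> real"
  assumes nonneg: "\<And>x. x \<ge> u \<Longrightarrow> 0 \<le> f x"
    and int: "\<And>v. v \<ge> u \<Longrightarrow> integrable lborel (\<lambda>x. f x * indicator {u..v} x)"
    and bound: "\<And>v. v \<ge> u \<Longrightarrow> (LINT x|lborel. f x * indicator {u..v} x) \<le> C"
  shows "integrable lborel (\<lambda>x. f x * indicator {u..} x)"
proof -
  define F where "F i x = f x * indicator {u..u + real i} x" for i x
  have intF: "integrable lborel (F i)" for i
    unfolding F_def by (rule int) simp
  have mono: "mono (\<lambda>i. F i x)" for x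
    by (rule monoI) (auto simp: F_def indicator_def nonneg)
  have "incseq (\<lambda>i. LINT x|lborel. F i x)"
    using mono by (intro monoI integral_mono intF) (auto simp: mono_def)
  moreover have "(LINT x|lborel. F i x) \<le> C" for i
    unfolding F_def by (rule bound) simp
  ultimately obtain L where L: "(\<lambda>i. LINT x|lborel. F i x) \<longlonglongrightarrow> L"
    using incseq_convergent[of "\<lambda>i. LINT x|lborel. F i x" C] by blast
  have lim: "(\<lambda>i. F i x) \<longlonglongrightarrow> f x * indicator {u..} x" for x
  proof (rule tendsto_eventually)
    obtain N :: nat where "x - u \<le> real N"
      using real_arch_simple by blast
    then show "\<forall>\<^sub>F i in sequentially. F i x = f x * indicator {u..} x"
      by (intro eventually_sequentiallyI[of N]) (auto simp: F_def indicator_def)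
  qed
  have "(\<lambda>x. f x * indicator {u..} x) \<in> borel_measurable lborel"
    by (rule borel_measurable_LIMSEQ_real[OF lim]) (use intF in auto)
  then show ?thesis
    by (intro integrable_monotone_convergence[OF intF _ _ L]) (use mono lim in auto)
qed

text \<open>The right side does not depend on \<open>u\<close> and \<open>v\<close>, so an
  antiderivative that grows without bound contradicts integrability of \<open>q\<close>. It is
  applied with logarithms as \<open>V\<close>.\<close>

lemma antiderivative_increment_le_integral:
  fixes q V V' :: "real \<Rightarrow> real"
  assumes "u \<le> v" and int: "integrable lborel q" and q: "\<And>x. 0 \<le> q x"
    and V: "\<And>x. u \<le> x \<Longrightarrow> x \<le> v \<Longrightarrow> (V has_real_derivative V' x) (at x)"
    and cont: "\<And>x. u \<le> x \<Longrightarrow> x \<le> v \<Longrightarrow> isCont V' x"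
    and le: "\<And>x. u \<le> x \<Longrightarrow> x \<le> v \<Longrightarrow> V' x \<le> q x"
  shows "V v - V u \<le> (LINT x|lborel. q x)"
proof -
  note ftc = has_bochner_integral_FTC_Icc_real[OF \<open>u \<le> v\<close> V cont, simplified]
  have "V v - V u = (LINT x|lborel. V' x * indicator {u..v} x)"
    using ftc by (simp add: has_bochner_integral_iff)
  also have "\<dots> \<le> (LINT x|lborel. q x)"
    using ftc int q le by (intro integral_mono) (auto simp: has_bochner_integral_iff indicator_def)
  finally show ?thesis .
qed

text \<open>The parameter \<open>\<kappa>\<close> is an arbitrary real rather than an index \<open>k\<close>, so that the family is closed
  under the reflection \<open>t \<mapsto> - t\<close>.\<close>

locale pearson_density =
  fixes T :: "real set" and p :: "real \<Rightarrow> real" and a b c \<kappa> \<nu> :: real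
  assumes interval: "is_interval T" "open T" "T \<noteq> {}"
    and pos: "\<And>t. t \<in> T \<Longrightarrow> 0 < a * t\<^sup>2 + b * t + c"
    and frontier_zero: "\<And>t. t \<in> frontier T \<Longrightarrow> a * t\<^sup>2 + b * t + c = 0"
    and p_meas [measurable]: "p \<in> borel_measurable borel"
    and p_nonneg: "\<And>t. 0 \<le> p t"
    and p_int: "integrable lborel p"
    and p_zero: "\<And>t. t \<notin> closure T \<Longrightarrow> p t = 0"
    and p_deriv: "\<And>t. t \<in> T \<Longrightarrow> (p has_real_derivative (\<kappa> - \<nu> * t) * p t / (a * t\<^sup>2 + b * t + c)) (at t)"
    and \<nu>: "0 < \<nu>" "3 * a < \<nu>"
begin

text \<open>Turns the left end of \<open>T\<close> into a right end, so that tails and boundary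
  terms have to be studied at the right end only.\<close>

lemma reflected: "pearson_density (uminus ` T) (\<lambda>t. p (- t)) a (- b) c (- \<kappa>) \<nu>"
proof
  have cl: "closure (uminus ` T) = uminus ` closure T"
    using closure_scaleR[of "-1" T] by (simp add: scaleR_conv_of_real image_def)
  have fr: "frontier (uminus ` T) = uminus ` frontier T"
    unfolding frontier_def cl interior_negations by auto
  show "is_interval (uminus ` T)" "uminus ` T \<noteq> {}"
    using interval by auto
  show "open (uminus ` T)"
    using open_negations[OF interval(2)] by simp
  show "0 < a * t\<^sup>2 + - b * t + c" if "t \<in> uminus ` T" for t
    using that pos by force
  show "a * t\<^sup>2 + - b * t + c = 0" if "t \<in> frontier (uminus ` T)" for t
    using that frontier_zero unfolding fr by force
  show "p (- t) = 0" if "t \<notin> closure (uminus ` T)" for t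
    using that p_zero unfolding cl by (metis image_eqI minus_minus)
  show "integrable lborel (\<lambda>t. p (- t))"
    using lborel_integrable_real_affine[OF p_int, of "-1" 0] by simp
  show "((\<lambda>t. p (- t)) has_real_derivative
      (- \<kappa> - \<nu> * t) * p (- t) / (a * t\<^sup>2 + - b * t + c)) (at t)" if "t \<in> uminus ` T" for t
  proof -
    have "- t \<in> T" using that by auto
    have "((\<lambda>t. p (- t)) has_real_derivative
        (\<kappa> - \<nu> * (- t)) * p (- t) / (a * (- t)\<^sup>2 + b * (- t) + c) * - 1) (at t)"
      by (rule DERIV_chain2[where g = uminus and f = p, OF p_deriv[OF \<open>- t \<in> T\<close>]])
         (auto intro!: derivative_eq_intros)
    then show ?thesis
      by (rule back_subst[of "\<lambda>D. (_ has_real_derivative D) _"]) (simp add: divide_simps algebra_simps)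
  qed
qed (use p_nonneg \<nu> in auto)

section \<open>Existence of the moments and decay at the ends of \<open>T\<close>\<close>

text \<open>With s for the quadratic and w for the affine weight, s p' = (\<kappa> - \<nu> t) p.
  Hence (w s p)' = (w' s + w s' + w (\<kappa> - \<nu> t)) p, and no denominator is left.\<close>

lemma weighted_deriv:
  assumes "t \<in> T"
  shows "((\<lambda>t. (w\<^sub>0 + w\<^sub>1 * t) * (a * t\<^sup>2 + b * t + c) * p t) has_real_derivative
      ((w\<^sub>1 * c + w\<^sub>0 * (b + \<kappa>)) + (w\<^sub>1 * (2 * b + \<kappa>) + w\<^sub>0 * (2 * a - \<nu>)) * t
        + w\<^sub>1 * (3 * a - \<nu>) * t\<^sup>2) * p t) (at t)"
proof -
  have nz: "a * t\<^sup>2 + b * t + c \<noteq> 0"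
    using pos[OF assms] by simp
  show ?thesis
    apply (rule derivative_eq_intros p_deriv[OF assms] refl)+
    using nz by (simp add: field_simps power2_eq_square)
qed

lemma isCont_p: "t \<in> T \<Longrightarrow> isCont p t"
  using p_deriv DERIV_isCont by blast

lemma Icc_subset: "u \<in> T \<Longrightarrow> v \<in> T \<Longrightarrow> {u..v} \<subseteq> T"
  using interval(1) by (meson is_interval_1 atLeastAtMost_iff subsetI)

text \<open>If \<open>T\<close> is unbounded above, \<open>G t = t * (a * t\<^sup>2 + b * t + c) * p t\<close> is nonnegative and satisfies
  \<open>G' t \<le> - \<delta> * t\<^sup>2 * p t\<close> for large \<open>t\<close>; this is where \<open>3 * a < \<nu>\<close> enters.\<close>

lemma second_moment_right: "\<exists>M. integrable lborel (\<lambda>t. t\<^sup>2 * p t * indicator {M..} t)"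
proof (cases "\<exists>y. \<forall>t\<in>T. t < y")
  case True
  then obtain y where "T \<subseteq> {..y}" by (metis atMost_iff less_imp_le subsetI)
  then have "closure T \<subseteq> {..y}" by (simp add: closure_minimal)
  then have "(\<lambda>t. t\<^sup>2 * p t * indicator {y + 1..} t) = (\<lambda>t. 0)"
    using p_zero by (fastforce simp: indicator_def)
  then show ?thesis by (metis integrable_zero)
next
  case False
  obtain t0 where t0: "t0 \<in> T" using interval by blast
  have T: "t \<in> T" if "t0 \<le> t" for t
    using False Icc_subset[OF t0] that by (meson atLeastAtMost_iff not_less subsetD)
  \<comment> \<open>The coefficient \<open>3 * a - \<nu>\<close> of the leading term in
    \<open>G'\<close> is \<open>- 2 * \<delta>\<close>: one \<open>\<delta>\<close> absorbs the
    lower-order terms, the other one remains. Beyond \<open>M\<close>, \<open>1 \<le> t\<close>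
    bounds these terms by a multiple of \<open>t\<close>, and the quotient in \<open>M\<close>
    bounds that multiple by \<open>\<delta> * t\<^sup>2\<close>.\<close>
  define \<delta> where "\<delta> = (\<nu> - 3 * a) / 2"
  have \<delta>: "\<delta> > 0" using \<nu> by (simp add: \<delta>_def)
  define M where "M = max t0 (max 1 ((\<bar>c\<bar> + \<bar>2 * b + \<kappa>\<bar>) / \<delta>))"
  define G where "G t = t * (a * t\<^sup>2 + b * t + c) * p t" for t
  define G' where "G' t = (c + (2 * b + \<kappa>) * t + (3 * a - \<nu>) * t\<^sup>2) * p t" for t
  have G: "(G has_real_derivative G' t) (at t)" if "M \<le> t" for t
    using weighted_deriv[of t 0 1] T that by (simp add: G_def[abs_def] G'_def M_def)
  have G'_le: "\<delta> * (t\<^sup>2 * p t) \<le> - G' t" if "M \<le> t" for t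
  proof -
    have t: "1 \<le> t" "(\<bar>c\<bar> + \<bar>2 * b + \<kappa>\<bar>) / \<delta> \<le> t" using that by (auto simp: M_def)
    have "c + (2 * b + \<kappa>) * t \<le> \<bar>c\<bar> * t + \<bar>2 * b + \<kappa>\<bar> * t"
      using t(1) mult_left_mono[of 1 t "\<bar>c\<bar>"] by (intro add_mono mult_right_mono) auto
    also have "\<dots> = (\<bar>c\<bar> + \<bar>2 * b + \<kappa>\<bar>) * t" by (simp add: algebra_simps)
    also have "\<dots> \<le> \<delta> * t * t"
      using t \<delta> by (intro mult_right_mono) (auto simp: field_simps)
    finally have "\<delta> * t\<^sup>2 \<le> - (c + (2 * b + \<kappa>) * t + (3 * a - \<nu>) * t\<^sup>2)"
      by (simp add: \<delta>_def field_simps power2_eq_square)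
    from mult_right_mono[OF this p_nonneg[of t]] show ?thesis
      by (simp add: G'_def algebra_simps)
  qed
  have G_nonneg: "0 \<le> G t" if "M \<le> t" for t
  proof -
    have "0 \<le> t" "t \<in> T" using that T by (auto simp: M_def)
    then show ?thesis using pos[of t] p_nonneg[of t] by (simp add: G_def)
  qed
  have "integrable lborel (\<lambda>t. \<delta> * (t\<^sup>2 * p t) * indicator {M..} t)"
  proof (rule integrable_atLeast_if_bounded[where C = "G M"])
    show "0 \<le> \<delta> * (x\<^sup>2 * p x)" for x
      using \<delta> p_nonneg[of x] by simp
    fix v assume v: "M \<le> v"
    have cont: "isCont G' x" if "M \<le> x" for x
      using that T isCont_p[of x] unfolding G'_def[abs_def] M_def by (intro continuous_intros) auto
    \<comment> \<open>The integral from \<open>M\<close> to \<open>v\<close> is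
      \<open>G M - G v\<close>, which is at most \<open>G M\<close> for every \<open>v\<close>
      because \<open>G v\<close> is nonnegative.\<close>
    have ftc: "has_bochner_integral lborel (\<lambda>x. - G' x * indicator {M..v} x) (- G v - - G M)"
      by (rule has_bochner_integral_FTC_Icc_real[OF v]) (auto intro!: derivative_eq_intros G cont continuous_intros)
    show *: "integrable lborel (\<lambda>x. \<delta> * (x\<^sup>2 * p x) * indicator {M..v} x)"
    proof (rule Bochner_Integration.integrable_bound[OF integrable.intros[OF ftc]], measurable, intro AE_I2)
      fix x
      have "0 \<le> \<delta> * (x\<^sup>2 * p x)" using \<delta> p_nonneg[of x] by simp
      then show "norm (\<delta> * (x\<^sup>2 * p x) * indicator {M..v} x) \<le> norm (- G' x * indicator {M..v} x)"
        using G'_le[of x] by (auto simp: indicator_def)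
    qed
    have "(LINT x|lborel. \<delta> * (x\<^sup>2 * p x) * indicator {M..v} x)
        \<le> (LINT x|lborel. - G' x * indicator {M..v} x)"
      using ftc G'_le by (intro integral_mono *) (auto simp: has_bochner_integral_iff indicator_def)
    also have "\<dots> \<le> G M"
      using ftc G_nonneg[OF v] by (simp add: has_bochner_integral_iff)
    finally show "(LINT x|lborel. \<delta> * (x\<^sup>2 * p x) * indicator {M..v} x) \<le> G M" .
  qed
  then have "integrable lborel (\<lambda>t. inverse \<delta> * (\<delta> * (t\<^sup>2 * p t) * indicator {M..} t))"
    by (rule integrable_mult_right)
  then show ?thesis
    using \<delta> by (auto simp: mult.assoc[symmetric])
qed

text \<open>The right tail is \<open>second_moment_right\<close>, the left tail is the same for the
  reflected density, and between them \<open>t\<^sup>2\<close> is bounded, so that integrability of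
  \<open>p\<close> suffices.\<close>

lemma second_moment: "integrable lborel (\<lambda>t. t\<^sup>2 * p t)"
proof -
  obtain M where M: "integrable lborel (\<lambda>t. t\<^sup>2 * p t * indicator {M..} t)"
    using second_moment_right by blast
  interpret r: pearson_density "uminus ` T" "\<lambda>t. p (- t)" a "- b" c "- \<kappa>" \<nu>
    by (rule reflected)
  obtain N where "integrable lborel (\<lambda>t. t\<^sup>2 * p (- t) * indicator {N..} t)"
    using r.second_moment_right by blast
  from lborel_integrable_real_affine[OF this, of "-1" 0]
  have N: "integrable lborel (\<lambda>t. t\<^sup>2 * p t * indicator {N..} (- t))"
    by simp
  define R where "R = max \<bar>M\<bar> \<bar>N\<bar>"
  have "integrable lborel (\<lambda>t. R\<^sup>2 * p t + t\<^sup>2 * p t * indicator {M..} t + t\<^sup>2 * p t * indicator {N..} (- t))"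
    using M N p_int by (intro Bochner_Integration.integrable_add integrable_mult_right)
  then show ?thesis
  proof (rule Bochner_Integration.integrable_bound, measurable, intro AE_I2)
    fix t
    have nn: "0 \<le> R\<^sup>2 * p t" "0 \<le> t\<^sup>2 * p t" using p_nonneg[of t] by auto
    have "t\<^sup>2 \<le> R\<^sup>2" if "t < M" "- t < N"
      using that by (intro power2_le_iff_abs_le[THEN iffD2]) (auto simp: R_def)
    then have "t\<^sup>2 * p t \<le> R\<^sup>2 * p t" if "t < M" "- t < N"
      using that p_nonneg[of t] by (intro mult_right_mono) auto
    then show "norm (t\<^sup>2 * p t) \<le> norm (R\<^sup>2 * p t + t\<^sup>2 * p t * indicator {M..} t + t\<^sup>2 * p t * indicator {N..} (- t))"
      using nn by (auto simp: indicator_def not_le)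
  qed
qed

lemma first_moment: "integrable lborel (\<lambda>t. t * p t)"
proof -
  have "integrable lborel (\<lambda>t. p t + t\<^sup>2 * p t)"
    using p_int second_moment by simp
  then show ?thesis
  proof (rule Bochner_Integration.integrable_bound, measurable, intro AE_I2)
    fix t :: real
    have "\<bar>t\<bar> \<le> 1 + t\<^sup>2"
      using sum_squares_ge_zero[of "\<bar>t\<bar> - 1" t] by (simp add: power2_eq_square algebra_simps abs_if split: if_splits)
    from mult_right_mono[OF this p_nonneg[of t]]
    show "norm (t * p t) \<le> norm (p t + t\<^sup>2 * p t)"
      using p_nonneg[of t] by (simp add: abs_mult algebra_simps)
  qed
qed


text \<open>Otherwise \<open>p t\<close> would be bounded below by a multiple of \<open>1 / (r - t)\<close> near a finite right
  endpoint \<open>r\<close>, or \<open>t\<^sup>2 * p t\<close> by a multiple of \<open>1 / t\<close> near infinity, and neither is integrable.\<close>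

lemma weight_small_right:
  assumes "u\<^sub>0 \<in> T" "0 < \<epsilon>"
  shows "\<exists>t\<in>T. u\<^sub>0 < t \<and> \<bar>(w\<^sub>0 + w\<^sub>1 * t) * (a * t\<^sup>2 + b * t + c) * p t\<bar> < \<epsilon>"
proof (rule ccontr)
  assume "\<not> ?thesis"
  then have big: "\<epsilon> \<le> \<bar>(w\<^sub>0 + w\<^sub>1 * t) * (a * t\<^sup>2 + b * t + c)\<bar> * p t" if "t \<in> T" "u\<^sub>0 < t" for t
    using that p_nonneg[of t] by (force simp: abs_mult)
  show False
  proof (cases "\<exists>y. \<forall>t\<in>T. t < y")
    case True
    then have bdd: "bdd_above T" by (meson bdd_aboveI less_imp_le)
    define r where "r = Sup T"
    have lt_r: "t < r" if "t \<in> T" for t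
    proof -
      obtain e where "0 < e" "ball t e \<subseteq> T"
        using interval(2) \<open>t \<in> T\<close> by (meson openE)
      then have "t + e / 2 \<in> T" by (auto simp: dist_real_def subset_iff)
      from cSup_upper[OF this bdd] show ?thesis using \<open>0 < e\<close> by (simp add: r_def)
    qed
    have inT: "t \<in> T" if "u\<^sub>0 \<le> t" "t < r" for t
    proof -
      obtain v where "v \<in> T" "t < v"
        using less_cSup_iff[OF interval(3) bdd] \<open>t < r\<close> by (auto simp: r_def)
      then show ?thesis using Icc_subset[OF assms(1)] that by force
    qed
    have "r \<in> frontier T"
      using closure_contains_Sup[OF interval(3) bdd] lt_r interior_open[OF interval(2)]
      by (auto simp: frontier_def r_def)
    then have r0: "a * r\<^sup>2 + b * r + c = 0" by (rule frontier_zero)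
    \<comment> \<open>Since \<open>r\<close> is a root, the quadratic equals
      \<open>(t - r) * (a * (r + t) + b)\<close>; \<open>g\<close> is the weight times this
      cofactor.\<close>
    define g where "g t = (w\<^sub>0 + w\<^sub>1 * t) * (a * (r + t) + b)" for t
    have "compact (g ` {u\<^sub>0..r})"
      unfolding g_def by (intro compact_continuous_image continuous_intros compact_Icc)
    then obtain C where C: "\<And>t. t \<in> {u\<^sub>0..r} \<Longrightarrow> \<bar>g t\<bar> \<le> C" and "0 < C"
      using bounded_pos[of "g ` {u\<^sub>0..r}"] compact_imp_bounded by force
    have lower: "\<epsilon> / C / (r - t) \<le> p t" if "u\<^sub>0 < t" "t < r" for t
    proof -
      have eq: "(w\<^sub>0 + w\<^sub>1 * t) * (a * t\<^sup>2 + b * t + c) = - g t * (r - t)"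
        using r0 unfolding g_def by algebra
      have "\<epsilon> \<le> \<bar>g t\<bar> * (r - t) * p t"
        using big[OF inT, of t] that unfolding eq by (simp add: abs_mult)
      also have "\<dots> \<le> C * (r - t) * p t"
        using C[of t] that p_nonneg[of t] by (intro mult_right_mono) auto
      finally show ?thesis using that \<open>0 < C\<close> by (simp add: field_simps)
    qed
    define u where "u = (u\<^sub>0 + r) / 2"
    have u: "u\<^sub>0 < u" "u < r" using lt_r[OF assms(1)] by (auto simp: u_def)
    define I where "I = (LINT x|lborel. p x)"
    have I: "0 \<le> I" unfolding I_def using p_nonneg by simp
    \<comment> \<open>Chosen so that \<open>- (\<epsilon> / C) * ln (r - x)\<close> grows by exactly
      \<open>I + 1\<close> from \<open>u\<close> to \<open>v\<close>, which exceeds the whole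
      integral of \<open>p\<close>.\<close>
    define v where "v = r - (r - u) * exp (- (I + 1) * C / \<epsilon>)"
    have e1: "exp (- (I + 1) * C / \<epsilon>) \<le> 1"
      using I \<open>0 < C\<close> assms(2) by (simp add: divide_le_0_iff mult_le_0_iff)
    have "u \<le> v"
      using mult_left_mono[OF e1, of "r - u"] u unfolding v_def mult_1_right by linarith
    have v: "v < r" using u by (simp add: v_def)
    have "- (\<epsilon> / C) * ln (r - v) - - (\<epsilon> / C) * ln (r - u) \<le> (LINT x|lborel. p x)"
    proof (rule antiderivative_increment_le_integral[OF \<open>u \<le> v\<close> p_int p_nonneg])
      fix x assume x: "u \<le> x" "x \<le> v"
      show "((\<lambda>x. - (\<epsilon> / C) * ln (r - x)) has_real_derivative \<epsilon> / C / (r - x)) (at x)"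
      proof -
        have "((\<lambda>x. - k * ln (r - x)) has_real_derivative k / (r - x)) (at x)" for k
          using x v by (auto intro!: derivative_eq_intros)
        then show ?thesis .
      qed
      show "isCont (\<lambda>x. \<epsilon> / C / (r - x)) x"
        using x v by (intro continuous_intros) auto
      show "\<epsilon> / C / (r - x) \<le> p x" using x u v by (intro lower) auto
    qed
    moreover have "ln (r - v) = ln (r - u) + - (I + 1) * C / \<epsilon>"
      using u by (simp add: v_def ln_mult)
    ultimately have "\<epsilon> / C * ((I + 1) * C / \<epsilon>) \<le> I"
      unfolding I_def[symmetric] by (simp add: algebra_simps)
    then show False using \<open>0 < C\<close> assms(2) by simp
  next
    case False
    have inT: "t \<in> T" if "u\<^sub>0 \<le> t" for t
      using False Icc_subset[OF assms(1)] that by (meson atLeastAtMost_iff not_less subsetD)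
    \<comment> \<open>For \<open>1 \<le> t\<close> the weight is at most a multiple of
      \<open>t\<close> and the quadratic at most a multiple of \<open>t\<^sup>2\<close>, so
      \<open>C * (t * t\<^sup>2)\<close> bounds their product. The summand 1 keeps \<open>C\<close>
      positive.\<close>
    define C where "C = (\<bar>w\<^sub>0\<bar> + \<bar>w\<^sub>1\<bar>) * (\<bar>a\<bar> + \<bar>b\<bar> + \<bar>c\<bar>) + 1"
    have C: "0 < C" by (simp add: C_def add_nonneg_pos)
    have lower: "\<epsilon> / C / t \<le> t\<^sup>2 * p t" if "u\<^sub>0 < t" "1 \<le> t" for t
    proof -
      have t: "1 \<le> t\<^sup>2" "t \<le> t\<^sup>2" using that(2) by (auto simp: self_le_power)
      have "\<bar>w\<^sub>0 + w\<^sub>1 * t\<bar> \<le> \<bar>w\<^sub>0\<bar> * 1 + \<bar>w\<^sub>1\<bar> * t"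
        using that abs_triangle_ineq[of w\<^sub>0 "w\<^sub>1 * t"] by (simp add: abs_mult)
      also have "\<dots> \<le> \<bar>w\<^sub>0\<bar> * t + \<bar>w\<^sub>1\<bar> * t"
        using that by (intro add_mono mult_left_mono) auto
      finally have 1: "\<bar>w\<^sub>0 + w\<^sub>1 * t\<bar> \<le> (\<bar>w\<^sub>0\<bar> + \<bar>w\<^sub>1\<bar>) * t" by (simp add: algebra_simps)
      have "\<bar>a * t\<^sup>2 + b * t + c\<bar> \<le> \<bar>a\<bar> * t\<^sup>2 + \<bar>b\<bar> * t + \<bar>c\<bar> * 1"
        using that abs_triangle_ineq[of "a * t\<^sup>2 + b * t" c] abs_triangle_ineq[of "a * t\<^sup>2" "b * t"]
        by (simp add: abs_mult)
      also have "\<dots> \<le> \<bar>a\<bar> * t\<^sup>2 + \<bar>b\<bar> * t\<^sup>2 + \<bar>c\<bar> * t\<^sup>2"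
        using t by (intro add_mono mult_left_mono) auto
      finally have 2: "\<bar>a * t\<^sup>2 + b * t + c\<bar> \<le> (\<bar>a\<bar> + \<bar>b\<bar> + \<bar>c\<bar>) * t\<^sup>2" by (simp add: algebra_simps)
      have "\<bar>w\<^sub>0 + w\<^sub>1 * t\<bar> * \<bar>a * t\<^sup>2 + b * t + c\<bar>
          \<le> ((\<bar>w\<^sub>0\<bar> + \<bar>w\<^sub>1\<bar>) * t) * ((\<bar>a\<bar> + \<bar>b\<bar> + \<bar>c\<bar>) * t\<^sup>2)"
        using that by (intro mult_mono 1 2) auto
      also have "\<dots> \<le> C * (t * t\<^sup>2)"
        using that unfolding C_def by (simp add: algebra_simps)
      finally have 3: "\<bar>(w\<^sub>0 + w\<^sub>1 * t) * (a * t\<^sup>2 + b * t + c)\<bar> \<le> C * (t * t\<^sup>2)"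
        by (simp add: abs_mult)
      have "\<epsilon> \<le> C * (t * t\<^sup>2) * p t"
        using big[OF inT, of t] mult_right_mono[OF 3 p_nonneg[of t]] that by linarith
      then show ?thesis using that C by (simp add: field_simps)
    qed
    define u where "u = max (u\<^sub>0 + 1) 1"
    have u: "u\<^sub>0 < u" "1 \<le> u" by (auto simp: u_def)
    define I where "I = (LINT x|lborel. x\<^sup>2 * p x)"
    have I: "0 \<le> I" unfolding I_def using p_nonneg by simp
    \<comment> \<open>Again the antiderivative, now \<open>\<epsilon> / C * ln x\<close>, grows by
      exactly \<open>I + 1\<close> from \<open>u\<close> to \<open>v\<close>.\<close>
    define v where "v = u * exp ((I + 1) * C / \<epsilon>)"
    have e1: "1 \<le> exp ((I + 1) * C / \<epsilon>)"
      using I C assms(2) by simp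
    have "u \<le> v"
      using mult_left_mono[OF e1, of u] u unfolding v_def by simp
    have "\<epsilon> / C * ln v - \<epsilon> / C * ln u \<le> (LINT x|lborel. x\<^sup>2 * p x)"
    proof (rule antiderivative_increment_le_integral[OF \<open>u \<le> v\<close> second_moment])
      fix x
      show "0 \<le> x\<^sup>2 * p x" using p_nonneg by simp
      assume x: "u \<le> x" "x \<le> v"
      show "((\<lambda>x. \<epsilon> / C * ln x) has_real_derivative \<epsilon> / C / x) (at x)"
      proof -
        have "((\<lambda>x. k * ln x) has_real_derivative k / x) (at x)" for k
          using x u by (auto intro!: derivative_eq_intros)
        then show ?thesis .
      qed
      show "isCont (\<lambda>x. \<epsilon> / C / x) x"
        using x u by (intro continuous_intros) auto
      show "\<epsilon> / C / x \<le> x\<^sup>2 * p x" using x u by (intro lower) auto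
    qed
    moreover have "ln v = ln u + (I + 1) * C / \<epsilon>"
      using u by (simp add: v_def ln_mult)
    ultimately have "\<epsilon> / C * ((I + 1) * C / \<epsilon>) \<le> I"
      unfolding I_def[symmetric] by (simp add: algebra_simps)
    then show False using C assms(2) by simp
  qed
qed

text \<open>By reflection; as a function of the reflected variable the weight has slope
  \<open>- w\<^sub>1\<close>.\<close>

lemma weight_small_left:
  assumes "u\<^sub>0 \<in> T" "0 < \<epsilon>"
  shows "\<exists>t\<in>T. t < u\<^sub>0 \<and> \<bar>(w\<^sub>0 + w\<^sub>1 * t) * (a * t\<^sup>2 + b * t + c) * p t\<bar> < \<epsilon>"
proof -
  interpret r: pearson_density "uminus ` T" "\<lambda>t. p (- t)" a "- b" c "- \<kappa>" \<nu>
    by (rule reflected)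
  obtain t where "t \<in> T" "- u\<^sub>0 < - t"
      "\<bar>(w\<^sub>0 + - w\<^sub>1 * (- t)) * (a * (- t)\<^sup>2 + - b * (- t) + c) * p (- (- t))\<bar> < \<epsilon>"
    using r.weight_small_right[of "- u\<^sub>0" \<epsilon> w\<^sub>0 "- w\<^sub>1"] assms by blast
  then show ?thesis by (intro bexI[of _ t]) auto
qed

section \<open>Integration over \<open>T\<close> and the variance of a Pearson density\<close>

text \<open>The assumptions leave \<open>p\<close> free on the frontier of \<open>T\<close>, but
  that set consists of roots of a nonzero polynomial and is finite.\<close>

lemma p_zero_AE: "AE t in lborel. t \<notin> T \<longrightarrow> p t = 0"
proof -
  have "[:c, b, a:] \<noteq> 0"
    using interval(3) pos by fastforce
  then have "finite {t. poly [:c, b, a:] t = 0}"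
    by (rule poly_roots_finite)
  moreover have "frontier T \<subseteq> {t. poly [:c, b, a:] t = 0}"
    using frontier_zero by (auto simp: power2_eq_square algebra_simps)
  ultimately have "frontier T \<in> null_sets lborel"
    by (meson finite_subset finite_imp_null_set_lborel)
  then show ?thesis
    by (rule AE_I'[of _ _ "\<lambda>t. t \<notin> T \<longrightarrow> p t = 0"])
       (use p_zero interior_open[OF interval(2)] in \<open>auto simp: frontier_def\<close>)
qed

lemma quadratic_integrable: "integrable lborel (\<lambda>t. (q\<^sub>0 + q\<^sub>1 * t + q\<^sub>2 * t\<^sup>2) * p t)"
proof -
  have "integrable lborel (\<lambda>t. q\<^sub>0 * p t + q\<^sub>1 * (t * p t) + q\<^sub>2 * (t\<^sup>2 * p t))"
    by (intro Bochner_Integration.integrable_add integrable_mult_right p_int first_moment second_moment)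
  then show ?thesis by (simp add: algebra_simps)
qed

text \<open>Integrating \<open>weighted_deriv\<close> over \<open>T\<close> leaves only boundary
  terms. It is enough that these become small along one sequence towards each end, which is what
  \<open>weight_small_right\<close> and \<open>weight_small_left\<close> provide.\<close>

lemma integral_weighted_deriv:
  "(LINT t|lborel. ((w\<^sub>1 * c + w\<^sub>0 * (b + \<kappa>)) + (w\<^sub>1 * (2 * b + \<kappa>) + w\<^sub>0 * (2 * a - \<nu>)) * t
        + w\<^sub>1 * (3 * a - \<nu>) * t\<^sup>2) * p t) = 0"
proof -
  define G where "G t = (w\<^sub>0 + w\<^sub>1 * t) * (a * t\<^sup>2 + b * t + c) * p t" for t
  define Q where "Q t = ((w\<^sub>1 * c + w\<^sub>0 * (b + \<kappa>)) + (w\<^sub>1 * (2 * b + \<kappa>) + w\<^sub>0 * (2 * a - \<nu>)) * t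
        + w\<^sub>1 * (3 * a - \<nu>) * t\<^sup>2) * p t" for t
  have Q_int: "integrable lborel Q"
    unfolding Q_def by (rule quadratic_integrable)
  have G: "(G has_real_derivative Q t) (at t)" if "t \<in> T" for t
    unfolding G_def[abs_def] Q_def by (rule weighted_deriv[OF that])
  have Q_cont: "isCont Q t" if "t \<in> T" for t
    using isCont_p[OF that] unfolding Q_def[abs_def] by (intro continuous_intros)
  obtain K :: "nat \<Rightarrow> real set" where K: "\<And>n. compact (K n)" "\<And>n. K n \<subseteq> T"
      "\<And>S. compact S \<Longrightarrow> S \<subseteq> T \<Longrightarrow> \<exists>N. \<forall>n\<ge>N. S \<subseteq> K n"
    by (rule open_Union_compact_subsets[OF interval(2)]) (rule that)
  obtain t0 where "t0 \<in> T" using interval(3) by blast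
  \<comment> \<open>Placing \<open>v i\<close> beyond \<open>K i\<close> makes the intervals
    eventually contain each point of \<open>T\<close>. Inserting \<open>t0\<close> provides a
    maximum even if \<open>K i\<close> is empty and later gives \<open>u i < v i\<close>.\<close>
  have "\<exists>v\<in>T. \<bar>G v\<bar> < 1 / real (Suc i) \<and> t0 < v \<and> (\<forall>t\<in>K i. t < v)" for i
  proof -
    have "compact (insert t0 (K i))" using K(1) by simp
    from compact_attains_sup[OF this] obtain s where s: "s \<in> insert t0 (K i)" "\<forall>t\<in>insert t0 (K i). t \<le> s"
      by blast
    have "s \<in> T" using s(1) K(2) \<open>t0 \<in> T\<close> by blast
    then obtain v where "v \<in> T" "s < v" "\<bar>G v\<bar> < 1 / real (Suc i)"
      using weight_small_right[of s "1 / real (Suc i)" w\<^sub>0 w\<^sub>1] unfolding G_def by auto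
    then show ?thesis using s(2) by (intro bexI[of _ v]) (auto intro: le_less_trans)
  qed
  then obtain v where v: "\<And>i. v i \<in> T" "\<And>i. \<bar>G (v i)\<bar> < 1 / real (Suc i)" "\<And>i. t0 < v i"
      "\<And>i t. t \<in> K i \<Longrightarrow> t < v i" by metis
  have "\<exists>u\<in>T. \<bar>G u\<bar> < 1 / real (Suc i) \<and> u < t0 \<and> (\<forall>t\<in>K i. u < t)" for i
  proof -
    have "compact (insert t0 (K i))" using K(1) by simp
    from compact_attains_inf[OF this] obtain s where s: "s \<in> insert t0 (K i)" "\<forall>t\<in>insert t0 (K i). s \<le> t"
      by blast
    have "s \<in> T" using s(1) K(2) \<open>t0 \<in> T\<close> by blast
    then obtain u where "u \<in> T" "u < s" "\<bar>G u\<bar> < 1 / real (Suc i)"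
      using weight_small_left[of s "1 / real (Suc i)" w\<^sub>0 w\<^sub>1] unfolding G_def by auto
    then show ?thesis using s(2) by (intro bexI[of _ u]) (auto intro: less_le_trans)
  qed
  then obtain u where u: "\<And>i. u i \<in> T" "\<And>i. \<bar>G (u i)\<bar> < 1 / real (Suc i)" "\<And>i. u i < t0"
      "\<And>i t. t \<in> K i \<Longrightarrow> u i < t" by metis
  have ftc: "(LINT t|lborel. Q t * indicator {u i..v i} t) = G (v i) - G (u i)" for i
    using Icc_subset[OF u(1)[of i] v(1)[of i]] u(3)[of i] v(3)[of i]
    by (intro integral_FTC_Icc_real G Q_cont) auto
  have G_lim: "(\<lambda>i. G (s i)) \<longlonglongrightarrow> 0" if "\<And>i. \<bar>G (s i)\<bar> < 1 / real (Suc i)" for s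
    by (rule Lim_null_comparison[OF _ lim_1_over_n[THEN LIMSEQ_Suc]])
       (use that in \<open>auto intro!: always_eventually less_imp_le\<close>)
  have "(\<lambda>i. LINT t|lborel. Q t * indicator {u i..v i} t) \<longlonglongrightarrow> 0"
    unfolding ftc using tendsto_diff[OF G_lim[OF v(2)] G_lim[OF u(2)]] by simp
  \<comment> \<open>\<open>norm (Q t)\<close> is the majorant. At points of \<open>T\<close> the
    sequence is eventually constant; off \<open>T\<close> everything vanishes almost
    everywhere.\<close>
  moreover have "(\<lambda>i. LINT t|lborel. Q t * indicator {u i..v i} t) \<longlonglongrightarrow> (LINT t|lborel. Q t)"
  proof (rule integral_dominated_convergence[where w = "\<lambda>t. norm (Q t)"])
    show "AE t in lborel. (\<lambda>i. Q t * indicator {u i..v i} t) \<longlonglongrightarrow> Q t"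
      using p_zero_AE
    proof eventually_elim
      case (elim t)
      show ?case
      proof (cases "t \<in> T")
        case True
        then obtain N where "\<forall>n\<ge>N. {t} \<subseteq> K n" using K(3)[of "{t}"] by auto
        then have "\<forall>\<^sub>F i in sequentially. Q t * indicator {u i..v i} t = Q t"
          using u(4) v(4) by (intro eventually_sequentiallyI[of N]) (auto simp: indicator_def less_imp_le)
        then show ?thesis by (rule tendsto_eventually)
      next
        case False
        then show ?thesis using elim by (simp add: Q_def)
      qed
    qed
  qed (use Q_int in \<open>auto simp: indicator_def\<close>)
  ultimately show ?thesis
    unfolding Q_def[symmetric] by (rule LIMSEQ_unique[symmetric])
qed

lemma two_a_less: "2 * a < \<nu>"
  using \<nu> by linarith

lemma integral_quadratic:
  "(LINT t|lborel. (q\<^sub>0 + q\<^sub>1 * t + q\<^sub>2 * t\<^sup>2) * p t)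
    = q\<^sub>0 * (LINT t|lborel. p t) + q\<^sub>1 * (LINT t|lborel. t * p t) + q\<^sub>2 * (LINT t|lborel. t\<^sup>2 * p t)"
proof -
  have "(LINT t|lborel. (q\<^sub>0 + q\<^sub>1 * t + q\<^sub>2 * t\<^sup>2) * p t)
      = (LINT t|lborel. q\<^sub>0 * p t + q\<^sub>1 * (t * p t) + q\<^sub>2 * (t\<^sup>2 * p t))"
    by (simp add: algebra_simps)
  also have "\<dots> = (LINT t|lborel. q\<^sub>0 * p t) + (LINT t|lborel. q\<^sub>1 * (t * p t)) + (LINT t|lborel. q\<^sub>2 * (t\<^sup>2 * p t))"
    using p_int first_moment second_moment by simp
  finally show ?thesis by simp
qed

text \<open>The weights 1 and t give two linear equations for the first two moments. Replacing
  \<open>\<kappa>\<close> by its expression in the mean \<open>m\<close> turns the variance into the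
  quadratic at \<open>m\<close> over \<open>\<nu> - 3 * a\<close>.\<close>

lemma second_moment_about:
  assumes "(LINT t|lborel. p t) = 1" and m: "m = (\<kappa> + b) / (\<nu> - 2 * a)"
  shows "(LINT t|lborel. (t - y)\<^sup>2 * p t) = (a * m\<^sup>2 + b * m + c) / (\<nu> - 3 * a) + (m - y)\<^sup>2"
proof -
  let ?m1 = "LINT t|lborel. t * p t" and ?m2 = "LINT t|lborel. t\<^sup>2 * p t"
  \<comment> \<open>In order of occurrence \<open>w\<^sub>1\<close> precedes
    \<open>w\<^sub>0\<close>, so \<open>of 0 1\<close> is the constant weight 1 and
    \<open>of 1 0\<close>, below, the weight t.\<close>
  have "b + \<kappa> + (2 * a - \<nu>) * ?m1 = 0"
    using integral_weighted_deriv[of 0 1] assms(1) unfolding integral_quadratic by simp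
  then have m1: "?m1 = m"
    using two_a_less unfolding m by (simp add: field_simps)
  have k: "\<kappa> = (\<nu> - 2 * a) * m - b"
    using two_a_less unfolding m by simp
  have "c + (2 * b + \<kappa>) * ?m1 + (3 * a - \<nu>) * ?m2 = 0"
    using integral_weighted_deriv[of 1 0] assms(1) unfolding integral_quadratic by simp
  then have "(\<nu> - 3 * a) * ?m2 = c + (2 * b + \<kappa>) * m"
    unfolding m1 by (simp add: algebra_simps)
  also have "\<dots> = (a * m\<^sup>2 + b * m + c) + (\<nu> - 3 * a) * m\<^sup>2"
    unfolding k by (simp add: algebra_simps power2_eq_square)
  finally have m2: "?m2 = (a * m\<^sup>2 + b * m + c) / (\<nu> - 3 * a) + m\<^sup>2"
    using \<nu> by (simp add: field_simps)
  have "(LINT t|lborel. (t - y)\<^sup>2 * p t) = (LINT t|lborel. (y\<^sup>2 + (- 2 * y) * t + 1 * t\<^sup>2) * p t)"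
    by (simp add: power2_eq_square algebra_simps)
  also have "\<dots> = y\<^sup>2 - 2 * y * m + ?m2"
    unfolding integral_quadratic m1 assms(1) by simp
  finally show ?thesis unfolding m2 by (simp add: power2_eq_square algebra_simps)
qed

end

section \<open>Moments of the discrete distributions\<close>

text \<open>Rolle's theorem for the combination of \<open>f\<close> and \<open>g\<close> that takes
  equal values at \<open>u\<close> and \<open>v\<close>. The product form also covers points where
  \<open>g'\<close> vanishes.\<close>

lemma cauchy_mean_value:
  fixes f g :: "real \<Rightarrow> real"
  assumes "u < v" "continuous_on {u..v} f" "continuous_on {u..v} g"
    and f: "\<And>z. u < z \<Longrightarrow> z < v \<Longrightarrow> (f has_real_derivative f' z) (at z)"
    and g: "\<And>z. u < z \<Longrightarrow> z < v \<Longrightarrow> (g has_real_derivative g' z) (at z)"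
  obtains z where "u < z" "z < v" "(f v - f u) * g' z = (g v - g u) * f' z"
proof -
  let ?\<phi> = "\<lambda>z. (f v - f u) * g z - (g v - g u) * f z"
  have "\<exists>z. u < z \<and> z < v \<and> (\<lambda>y. ((f v - f u) * g' z - (g v - g u) * f' z) * y) = (\<lambda>_. 0)"
  proof (rule Rolle_deriv[OF assms(1), of ?\<phi>])
    show "?\<phi> u = ?\<phi> v" by (simp add: algebra_simps)
    show "continuous_on {u..v} ?\<phi>"
      by (intro continuous_intros assms)
    show "(?\<phi> has_derivative (\<lambda>y. ((f v - f u) * g' z - (g v - g u) * f' z) * y)) (at z)"
      if "u < z" "z < v" for z
      unfolding has_field_derivative_def[symmetric] using f[OF that] g[OF that]
      by (intro derivative_eq_intros) auto
  qed
  then obtain z where z: "u < z" "z < v"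
    and 0: "(\<lambda>y. ((f v - f u) * g' z - (g v - g u) * f' z) * y) = (\<lambda>_. 0)" by blast
  from fun_cong[OF 0, of 1] have "(f v - f u) * g' z = (g v - g u) * f' z" by simp
  with z show ?thesis by (rule that)
qed

text \<open>A structure B at one fixed \<open>n\<close>, with \<open>\<nu>\<close> for
  \<open>real n\<close>. Where \<open>\<beta> x = 0\<close>, the equation puts all mass at
  \<open>k = \<nu> * x\<close>.\<close>

locale discrete_exponential_family =
  fixes X :: "real set" and \<beta> :: "real \<Rightarrow> real" and B :: "nat \<Rightarrow> real \<Rightarrow> real" and \<nu> :: real
  assumes interval: "is_interval X" and nondegenerate: "\<exists>u\<in>X. \<exists>v\<in>X. u < v"
    and \<beta>_nonneg: "\<And>x. x \<in> X \<Longrightarrow> 0 \<le> \<beta> x"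
    and B_nonneg: "\<And>k x. x \<in> X \<Longrightarrow> 0 \<le> B k x"
    and B_le_1: "\<And>k x. x \<in> X \<Longrightarrow> B k x \<le> 1"
    and B_sums: "\<And>x. x \<in> X \<Longrightarrow> (\<lambda>k. B k x) sums 1"
    and B_moments: "\<And>m x. x \<in> X \<Longrightarrow> summable (\<lambda>k. real k ^ m * B k x)"
    and B_deriv: "\<And>k x. x \<in> X \<Longrightarrow> \<exists>D. (B k has_real_derivative D) (at x within X) \<and>
                 \<beta> x * D = (real k - \<nu> * x) * B k x"
    and \<nu>_pos: "0 < \<nu>"
begin

lemma B_continuous: "continuous_on X (B k)"
  using B_deriv by (meson DERIV_continuous continuous_on_eq_continuous_within)

text \<open>No regularity of \<open>\<beta>\<close> is assumed, so \<open>1 / \<beta>\<close> cannot be used to dominate the derivatives.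
  Instead the increments of \<open>B k\<close> are compared with those of the single function \<open>B j\<close> by Cauchy's
  mean value theorem, where \<open>\<beta>\<close> cancels, and Tannery's theorem applies along a sequence tending to
  \<open>x\<close> from one side.\<close>

lemma differentiate_power_series:
  assumes x: "x \<in> X" and j: "B j x \<noteq> 0" "real j \<noteq> \<nu> * x"
    and S: "\<And>y. y \<in> X \<Longrightarrow> (\<lambda>k. real k ^ p * B k y) sums (A + C * y)"
  shows "(\<lambda>k. real k ^ p * (real k - \<nu> * x) * B k x) sums (C * \<beta> x)"
proof -
  \<comment> \<open>\<open>\<psi>\<close> equals \<open>\<beta>\<close> times the derivative of
    \<open>B j\<close>. It is continuous even if \<open>\<beta>\<close> is not, and where it is
    nonzero, \<open>\<beta>\<close> is positive.\<close>
  define \<psi> where "\<psi> z = (real j - \<nu> * z) * B j z" for z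
  have \<psi>_cont: "continuous_on X \<psi>"
    unfolding \<psi>_def by (intro continuous_intros B_continuous)
  have "\<psi> x \<noteq> 0" using j by (simp add: \<psi>_def)
  obtain d where "0 < d" and d: "\<And>z. z \<in> X \<Longrightarrow> \<bar>z - x\<bar> < d \<Longrightarrow> \<psi> z \<noteq> 0"
  proof -
    have "0 < \<bar>\<psi> x\<bar>" using \<open>\<psi> x \<noteq> 0\<close> by simp
    then obtain d where "0 < d" "\<forall>z\<in>X. dist z x < d \<longrightarrow> dist (\<psi> z) (\<psi> x) < \<bar>\<psi> x\<bar>"
      using \<psi>_cont x unfolding continuous_on_iff by blast
    then show ?thesis by (intro that[of d]) (force simp: dist_real_def)+
  qed
  obtain y0 where y0: "y0 \<in> X" "y0 \<noteq> x" "\<bar>y0 - x\<bar> < d"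
  proof -
    obtain w where w: "w \<in> X" "w \<noteq> x" using nondegenerate by (metis less_irrefl)
    \<comment> \<open>\<open>e \<le> 1\<close> keeps the new point on the segment from
      \<open>x\<close> to \<open>w\<close>, inside \<open>X\<close>; the other bound keeps it within
      distance \<open>d\<close> of \<open>x\<close>.\<close>
    define e where "e = min 1 (d / (2 * \<bar>w - x\<bar>))"
    have e: "0 < e" "e \<le> 1" "e * \<bar>w - x\<bar> \<le> d / 2"
      using \<open>0 < d\<close> w by (auto simp: e_def min_def field_simps)
    have "x + e * (w - x) = (1 - e) * x + e * w" by (simp add: algebra_simps)
    moreover have "(1 - e) *\<^sub>R x + e *\<^sub>R w \<in> X"
      using e x w by (intro convexD is_interval_convex interval) auto
    ultimately have "x + e * (w - x) \<in> X" by simp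
    then show ?thesis
      using e w \<open>0 < d\<close> by (intro that[of "x + e * (w - x)"]) (auto simp: abs_mult)
  qed
  define l where "l = min x y0"
  define r where "r = max x y0"
  have lr: "l \<in> X" "r \<in> X" "l < r" "x \<in> {l..r}" "y0 \<in> {l..r}"
    using x y0 by (auto simp: l_def r_def min_def max_def)
  have sub: "{l..r} \<subseteq> X"
    using interval lr by (meson is_interval_1 atLeastAtMost_iff subsetI)
  have \<psi>_nz: "\<psi> z \<noteq> 0" if "z \<in> {l..r}" for z
    using that sub y0(3) by (intro d) (auto simp: l_def r_def)
  have \<beta>_pos: "0 < \<beta> z" if z: "z \<in> {l..r}" for z
  proof -
    have "\<beta> z \<noteq> 0"
      using B_deriv[of z j] \<psi>_nz[OF z] z sub by (auto simp: \<psi>_def)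
    then show ?thesis using \<beta>_nonneg[of z] z sub by force
  qed
  define B' where "B' k z = (real k - \<nu> * z) * B k z / \<beta> z" for k z
  have B'_within: "(B k has_real_derivative B' k z) (at z within X)" if z: "z \<in> {l..r}" for k z
  proof -
    obtain D where D: "(B k has_real_derivative D) (at z within X)" "\<beta> z * D = (real k - \<nu> * z) * B k z"
      using B_deriv[of z k] z sub by blast
    from D(2) \<beta>_pos[OF z] have "D = B' k z" by (simp add: B'_def field_simps)
    with D(1) show ?thesis by simp
  qed
  have B'_at: "(B k has_real_derivative B' k z) (at z)" if z: "l < z" "z < r" for k z
  proof -
    have "z \<in> interior X"
      using sub z interior_mono[OF sub] by (auto simp: interior_atLeastAtMost_real)
    then show ?thesis
      using B'_within[of z k] z at_within_interior[of z X] by simp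
  qed
  have cont: "continuous_on S (B k)" if "S \<subseteq> {l..r}" for S k
    using B_continuous continuous_on_subset sub that by (meson order_trans)
  obtain m where "0 < m" and m: "\<And>z. z \<in> {l..r} \<Longrightarrow> m \<le> \<bar>\<psi> z\<bar>"
  proof -
    have "continuous_on {l..r} (\<lambda>z. \<bar>\<psi> z\<bar>)"
      using \<psi>_cont sub by (intro continuous_intros) (auto intro: continuous_on_subset)
    then obtain z0 where "z0 \<in> {l..r}" "\<forall>z\<in>{l..r}. \<bar>\<psi> z0\<bar> \<le> \<bar>\<psi> z\<bar>"
      using continuous_attains_inf[of "{l..r}" "\<lambda>z. \<bar>\<psi> z\<bar>"] lr by auto
    then show ?thesis using \<psi>_nz[of z0] by (intro that[of "\<bar>\<psi> z0\<bar>"]) auto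
  qed
  \<comment> \<open>\<open>M\<close> dominates \<open>B k\<close> on \<open>{l..r}\<close>, since \<open>B k\<close> is nondecreasing there once \<open>k \<ge> \<nu> r\<close>.\<close>
  define M where "M k = B k r + (if real k < \<nu> * r then 1 else 0)" for k
  have B_le_M: "B k z \<le> M k" if z: "z \<in> {l..r}" for k z
  proof (cases "real k < \<nu> * r")
    case True
    then show ?thesis using B_le_1[of z k] B_nonneg[of r k] z sub lr by (auto simp: M_def)
  next
    case False
    have "B k z \<le> B k r"
    proof (rule DERIV_nonneg_imp_increasing_open[where f = "B k"])
      fix y assume y: "z < y" "y < r"
      then have "\<nu> * y \<le> \<nu> * r" using \<nu>_pos by simp
      then have "0 \<le> real k - \<nu> * y" using False by linarith
      moreover have "0 \<le> B k y" "0 < \<beta> y" using y z sub by (auto intro!: B_nonneg \<beta>_pos)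
      ultimately show "\<exists>D. (B k has_real_derivative D) (at y) \<and> 0 \<le> D"
        using y z by (intro exI[of _ "B' k y"] conjI B'_at) (auto simp: B'_def)
    next
      show "z \<le> r" "continuous_on {z..r} (B k)" using z by (auto intro: cont)
    qed
    then show ?thesis using False by (simp add: M_def)
  qed
  have M_nonneg: "0 \<le> M k" for k
    using B_nonneg[OF lr(2), of k] by (simp add: M_def)
  define R where "R = \<nu> * (\<bar>l\<bar> + \<bar>r\<bar>)"
  have R: "\<bar>real k - \<nu> * z\<bar> \<le> real k + R" if "z \<in> {l..r}" for k z
  proof -
    have "\<bar>\<nu> * z\<bar> \<le> R" unfolding R_def abs_mult using that \<nu>_pos by (intro mult_mono) auto
    then show ?thesis by linarith
  qed
  have R_nonneg: "0 \<le> R" using \<nu>_pos by (simp add: R_def)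
  define \<Delta> where "\<Delta> k y = (B k y - B k x) / (y - x)" for k y
  have \<Delta>_le: "\<bar>\<Delta> k y\<bar> \<le> \<bar>\<Delta> j y\<bar> * ((real k + R) * M k / m)" if y: "y \<in> {l..r}" "y \<noteq> x" for k y
  proof -
    obtain z where z: "z \<in> {l..r}" "(B k y - B k x) * B' j z = (B j y - B j x) * B' k z"
    proof -
      have *: "\<exists>z. u < z \<and> z < v \<and> (B k v - B k u) * B' j z = (B j v - B j u) * B' k z"
        if "u < v" "l \<le> u" "v \<le> r" for u v
        by (rule cauchy_mean_value[OF \<open>u < v\<close>, of "B k" "B j" "B' k" "B' j"])
           (use that in \<open>auto intro!: cont B'_at\<close>)
      show ?thesis
      proof (cases "x < y")
        case True
        then obtain z where "x < z" "z < y" "(B k y - B k x) * B' j z = (B j y - B j x) * B' k z"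
          using *[of x y] y lr by auto
        then show ?thesis using y lr by (intro that[of z]) auto
      next
        case False
        then obtain z where "y < z" "z < x" "(B k x - B k y) * B' j z = (B j x - B j y) * B' k z"
          using *[of y x] y lr by auto
        then show ?thesis using y lr by (intro that[of z]) (auto simp: algebra_simps)
      qed
    qed
    \<comment> \<open>\<open>B' k z\<close> and \<open>B' j z\<close> share the factor
      \<open>1 / \<beta> z\<close>, which cancels here.\<close>
    have "(B k y - B k x) * \<psi> z = (B j y - B j x) * ((real k - \<nu> * z) * B k z)"
      using z(2) \<beta>_pos[OF z(1)] by (simp add: B'_def \<psi>_def field_simps)
    then have "\<Delta> k y * \<psi> z = \<Delta> j y * ((real k - \<nu> * z) * B k z)"
      by (simp add: \<Delta>_def)
    then have "\<bar>\<Delta> k y\<bar> * \<bar>\<psi> z\<bar> = \<bar>\<Delta> j y\<bar> * (\<bar>real k - \<nu> * z\<bar> * \<bar>B k z\<bar>)"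
      by (metis abs_mult)
    moreover have "\<bar>\<Delta> k y\<bar> * m \<le> \<bar>\<Delta> k y\<bar> * \<bar>\<psi> z\<bar>"
      using m[OF z(1)] by (intro mult_left_mono) auto
    moreover have "\<bar>\<Delta> j y\<bar> * (\<bar>real k - \<nu> * z\<bar> * \<bar>B k z\<bar>) \<le> \<bar>\<Delta> j y\<bar> * ((real k + R) * M k)"
      using R[OF z(1)] B_le_M[OF z(1)] B_nonneg[of z k] z(1) sub R_nonneg M_nonneg
      by (intro mult_left_mono mult_mono) auto
    ultimately have "\<bar>\<Delta> k y\<bar> * m \<le> \<bar>\<Delta> j y\<bar> * ((real k + R) * M k)" by linarith
    then show ?thesis using \<open>0 < m\<close> by (simp add: field_simps)
  qed
  define y where "y i = x + (y0 - x) / real (Suc i)" for i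
  have y_in: "y i \<in> {l..r}" "y i \<noteq> x" for i
  proof -
    have "y i = (1 - 1 / real (Suc i)) *\<^sub>R x + (1 / real (Suc i)) *\<^sub>R y0"
      by (simp add: y_def diff_divide_distrib left_diff_distrib del: of_nat_Suc)
    also have "\<dots> \<in> {l..r}"
      using lr by (intro convexD convex_real_interval) (auto simp: field_simps)
    finally show "y i \<in> {l..r}" .
    show "y i \<noteq> x" using y0 by (simp add: y_def)
  qed
  have y_lim: "y \<longlonglongrightarrow> x"
    unfolding y_def
    using tendsto_add[OF tendsto_const tendsto_mult[OF tendsto_const LIMSEQ_Suc[OF lim_1_over_n]], of x "y0 - x"]
    by simp
  have \<Delta>_lim: "(\<lambda>i. \<Delta> k (y i)) \<longlonglongrightarrow> B' k x" for k
  proof -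
    have "((\<lambda>y. \<Delta> k y) \<longlongrightarrow> B' k x) (at x within X)"
      using B'_within[OF lr(4), of k] unfolding has_field_derivative_iff \<Delta>_def .
    moreover have "filterlim y (at x within X) sequentially"
      using y_lim y_in sub by (auto simp: filterlim_at intro!: always_eventually)
    ultimately show ?thesis by (rule filterlim_compose)
  qed
  obtain L where L: "\<And>i. \<bar>\<Delta> j (y i)\<bar> \<le> L"
    using convergent_imp_Bseq[of "\<lambda>i. \<Delta> j (y i)"] \<Delta>_lim[of j] unfolding convergent_def Bseq_def by auto
  define W where "W k = L * (real k ^ p * ((real k + R) * M k / m))" for k
  have W: "norm (real k ^ p * \<Delta> k (y i)) \<le> W k" for k i
  proof -
    have "\<bar>\<Delta> k (y i)\<bar> \<le> L * ((real k + R) * M k / m)"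
      using \<Delta>_le[OF y_in] L[of i] M_nonneg[of k] R_nonneg \<open>0 < m\<close>
      by (meson add_nonneg_nonneg divide_nonneg_pos mult_nonneg_nonneg mult_right_mono of_nat_0_le_iff order_trans)
    from mult_left_mono[OF this, of "real k ^ p"] show ?thesis
      by (simp add: W_def abs_mult algebra_simps)
  qed
  \<comment> \<open>All moments at \<open>r\<close> are finite, and \<open>M k\<close> differs from
    \<open>B k r\<close> for finitely many \<open>k\<close> only. The factor
    \<open>real k + R\<close> calls for the moments of order \<open>p\<close> and
    \<open>Suc p\<close>.\<close>
  have "summable W"
  proof -
    have fin: "finite {k. real k < \<nu> * r}"
    proof (rule finite_subset)
      show "{k. real k < \<nu> * r} \<subseteq> {..nat \<lceil>\<nu> * r\<rceil>}" by (auto; linarith)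
    qed simp
    from summable_mult[OF summable_add[OF summable_add[OF B_moments[OF lr(2), of "Suc p"]
      summable_mult[OF B_moments[OF lr(2), of p], of R]]
      summable_If_finite[OF fin, of "\<lambda>k. real k ^ p * (real k + R)"]], of "L / m"]
    have "summable (\<lambda>k. L / m * ((real k ^ (Suc p) * B k r + R * (real k ^ p * B k r))
        + (if real k < \<nu> * r then real k ^ p * (real k + R) else 0)))" .
    also have "(\<lambda>k. L / m * ((real k ^ (Suc p) * B k r + R * (real k ^ p * B k r))
        + (if real k < \<nu> * r then real k ^ p * (real k + R) else 0))) = W"
      by (auto simp: W_def M_def fun_eq_iff algebra_simps add_divide_distrib)
    finally show ?thesis .
  qed
  \<comment> \<open>The given sum is affine in \<open>y\<close>, so the difference quotients add up
    to exactly \<open>C\<close> for each \<open>i\<close>, and so does their limit.\<close>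
  have sum_\<Delta>: "(\<lambda>k. real k ^ p * \<Delta> k (y i)) sums C" for i
  proof -
    have "(\<lambda>k. (real k ^ p * B k (y i) - real k ^ p * B k x) / (y i - x))
        sums ((A + C * y i - (A + C * x)) / (y i - x))"
      using y_in sub x by (intro sums_divide sums_diff S) auto
    also have "(A + C * y i - (A + C * x)) / (y i - x) = C"
      using y_in[of i] by (simp add: field_simps)
    finally show ?thesis by (simp add: \<Delta>_def algebra_simps diff_divide_distrib)
  qed
  have tannery: "summable (\<lambda>k. norm (real k ^ p * B' k x)) \<and>
      (\<lambda>i. \<Sum>k. real k ^ p * \<Delta> k (y i)) \<longlonglongrightarrow> (\<Sum>k. real k ^ p * B' k x)"
  proof -
    have "\<And>k. (\<lambda>i. real k ^ p * \<Delta> k (y i)) \<longlonglongrightarrow> real k ^ p * B' k x"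
      by (intro tendsto_intros \<Delta>_lim)
    moreover have "\<forall>\<^sub>F (k, i) in sequentially \<times>\<^sub>F sequentially. norm (real k ^ p * \<Delta> k (y i)) \<le> W k"
      using W by (intro always_eventually) auto
    ultimately show ?thesis
      by (rule tannerys_theorem[OF _ _ \<open>summable W\<close> sequentially_bot, THEN conjunct2])
  qed
  moreover have "(\<Sum>k. real k ^ p * \<Delta> k (y i)) = C" for i
    using sum_\<Delta> by (rule sums_unique[symmetric])
  ultimately have "(\<Sum>k. real k ^ p * B' k x) = C"
    by (simp add: LIMSEQ_const_iff)
  with tannery have "(\<lambda>k. real k ^ p * B' k x) sums C"
    by (metis summable_norm_cancel summable_sums)
  from sums_mult[OF this, of "\<beta> x"] show ?thesis
    using \<beta>_pos[OF lr(4)] by (simp add: B'_def mult.assoc mult.commute mult.left_commute)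
qed

section \<open>Mean and variance of the discrete distribution\<close>

text \<open>Differentiation of the constant sum 1. If no admissible \<open>j\<close> exists, all
  mass sits at \<open>k = \<nu> * x\<close> and the mean is read off.\<close>

lemma mean_sums:
  assumes x: "x \<in> X"
  shows "(\<lambda>k. real k * B k x) sums (\<nu> * x)"
proof (cases "\<exists>j. B j x \<noteq> 0 \<and> real j \<noteq> \<nu> * x")
  case True
  then obtain j where "B j x \<noteq> 0" "real j \<noteq> \<nu> * x" by blast
  from differentiate_power_series[OF x this, of 0 1 0]
  have "(\<lambda>k. (real k - \<nu> * x) * B k x) sums 0" using B_sums by simp
  from sums_add[OF this sums_mult[OF B_sums[OF x], of "\<nu> * x"]]
  show ?thesis by (simp add: algebra_simps)
next
  case False
  then have "(\<lambda>k. real k * B k x) = (\<lambda>k. \<nu> * x * B k x)" by (auto simp: fun_eq_iff)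
  then show ?thesis using sums_mult[OF B_sums[OF x], of "\<nu> * x"] by simp
qed

text \<open>Differentiating the mean gives equality when an admissible \<open>j\<close> exists.
  Otherwise the variance is 0, while \<open>\<beta> x\<close> is only known to be nonnegative; hence
  an inequality.\<close>

lemma variance_le:
  assumes x: "x \<in> X"
  obtains V where "(\<lambda>k. (real k - \<nu> * x)\<^sup>2 * B k x) sums V" "V \<le> \<nu> * \<beta> x"
proof (cases "\<exists>j. B j x \<noteq> 0 \<and> real j \<noteq> \<nu> * x")
  case True
  then obtain j where "B j x \<noteq> 0" "real j \<noteq> \<nu> * x" by blast
  from differentiate_power_series[OF x this, of 1 0 \<nu>]
  have 1: "(\<lambda>k. real k * (real k - \<nu> * x) * B k x) sums (\<nu> * \<beta> x)" using mean_sums by simp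
  have "(\<lambda>k. real k * B k x - \<nu> * x * B k x) sums (\<nu> * x - \<nu> * x * 1)"
    by (intro sums_diff sums_mult mean_sums B_sums x)
  from sums_diff[OF 1 sums_mult[OF this, of "\<nu> * x"]]
  show ?thesis by (intro that[of "\<nu> * \<beta> x"]) (simp_all add: algebra_simps power2_eq_square)
next
  case False
  then have "(\<lambda>k. (real k - \<nu> * x)\<^sup>2 * B k x) = (\<lambda>k. 0)" by (auto simp: fun_eq_iff)
  then show ?thesis using \<beta>_nonneg[OF x] \<nu>_pos by (intro that[of 0]) auto
qed

end

section \<open>The approximation estimate\<close>

text \<open>Up to \<open>\<delta>\<close> monotonicity suffices. Beyond it, with
  \<open>s = t / \<delta>\<close>, subadditivity costs at most \<open>s + 1\<close> copies of
  \<open>\<omega> \<delta>\<close>, and \<open>s \<le> s\<^sup>2\<close> because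
  \<open>1 \<le> s\<close>.\<close>

lemma modulus_le_quadratic:
  assumes \<omega>: "modulus_of_continuity \<omega>" and "0 < \<delta>" "0 \<le> t"
  shows "\<omega> t \<le> \<omega> \<delta> * (1 + (t / \<delta>)\<^sup>2)"
proof -
  have mono: "\<omega> u \<le> \<omega> v" if "0 \<le> u" "u \<le> v" for u v
    using \<omega> that unfolding modulus_of_continuity_def mono_on_def by auto
  have sub: "\<omega> (u + v) \<le> \<omega> u + \<omega> v" if "0 \<le> u" "0 \<le> v" for u v
    using \<omega> that unfolding modulus_of_continuity_def by auto
  have nn: "0 \<le> \<omega> \<delta>" and zero: "\<omega> 0 = 0"
    using \<omega> \<open>0 < \<delta>\<close> unfolding modulus_of_continuity_def by auto
  have mult: "\<omega> (real m * \<delta>) \<le> real m * \<omega> \<delta>" for m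
  proof (induction m)
    case (Suc m)
    then show ?case
      using sub[of \<delta> "real m * \<delta>"] \<open>0 < \<delta>\<close> by (simp add: algebra_simps)
  qed (simp add: zero)
  show ?thesis
  proof (cases "t \<le> \<delta>")
    case True
    then have "\<omega> t \<le> \<omega> \<delta> * 1" using mono assms by simp
    also have "\<dots> \<le> \<omega> \<delta> * (1 + (t / \<delta>)\<^sup>2)" using nn by (intro mult_left_mono) auto
    finally show ?thesis .
  next
    case False
    define s where "s = t / \<delta>"
    have s: "1 \<le> s" using False \<open>0 < \<delta>\<close> by (simp add: s_def)
    define m where "m = nat \<lceil>s\<rceil>"
    have m: "s \<le> real m" "real m \<le> s + 1"
      using s unfolding m_def by linarith+
    have "\<omega> t \<le> \<omega> (real m * \<delta>)"
      using m(1) assms by (intro mono) (auto simp: s_def field_simps)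
    also have "\<dots> \<le> real m * \<omega> \<delta>" by (rule mult)
    also have "\<dots> \<le> (1 + s\<^sup>2) * \<omega> \<delta>"
      using m(2) s self_le_power[of s 2] nn by (intro mult_right_mono) auto
    finally show ?thesis by (simp add: s_def mult.commute)
  qed
qed

lemma H_class_borel_measurable:
  assumes \<omega>: "modulus_of_continuity \<omega>" and f: "f \<in> H_class \<omega>"
  shows "f \<in> borel_measurable borel"
proof (rule borel_measurable_continuous_onI, unfold continuous_on_iff, intro ballI allI impI)
  fix x \<epsilon> :: real
  assume "0 < \<epsilon>"
  have "continuous_on {0..} \<omega>" "\<omega> 0 = 0"
    using \<omega> unfolding modulus_of_continuity_def by auto
  then obtain d where "0 < d" and d: "\<And>u. 0 \<le> u \<Longrightarrow> u < d \<Longrightarrow> \<bar>\<omega> u\<bar> < \<epsilon>"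
    using \<open>0 < \<epsilon>\<close> unfolding continuous_on_iff dist_real_def
    by (metis abs_of_nonneg atLeast_iff diff_zero order_refl)
  show "\<exists>d>0. \<forall>x'\<in>UNIV. dist x' x < d \<longrightarrow> dist (f x') (f x) < \<epsilon>"
  proof (intro exI conjI ballI impI)
    fix x' assume "dist x' x < d"
    moreover have "\<bar>f x' - f x\<bar> \<le> \<omega> \<bar>x' - x\<bar>"
      using f by (auto simp: H_class_def)
    ultimately show "dist (f x') (f x) < \<epsilon>"
      using d[of "\<bar>x' - x\<bar>"] by (simp add: dist_real_def)
  qed (rule \<open>0 < d\<close>)
qed

text \<open>\<open>modulus_le_quadratic\<close> at the distance from \<open>y\<close> is integrated
  against \<open>p\<close>. The same majorant makes the integrand integrable although
  \<open>f\<close> may be unbounded.\<close>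

lemma H_class_expectation_bound:
  fixes p :: "real \<Rightarrow> real"
  assumes \<omega>: "modulus_of_continuity \<omega>" and f: "f \<in> H_class \<omega>" and "0 < \<delta>"
    and p: "\<And>t. 0 \<le> p t" "integrable lborel p" "(LINT t|lborel. p t) = 1"
    and p2: "integrable lborel (\<lambda>t. (t - y)\<^sup>2 * p t)"
  shows "\<bar>(LINT t|lborel. f t * p t) - f y\<bar>
    \<le> \<omega> \<delta> * (1 + (LINT t|lborel. (t - y)\<^sup>2 * p t) / \<delta>\<^sup>2)"
proof -
  have [measurable]: "f \<in> borel_measurable borel"
    by (rule H_class_borel_measurable[OF \<omega> f])
  have [measurable]: "p \<in> borel_measurable borel"
    using p(2) by simp
  define W where "W t = \<omega> \<delta> * (p t + (t - y)\<^sup>2 * p t / \<delta>\<^sup>2)" for t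
  have W_int: "integrable lborel W"
    unfolding W_def using p(2) p2 by simp
  have le: "norm ((f t - f y) * p t) \<le> W t" for t
  proof -
    have "\<bar>f t - f y\<bar> \<le> \<omega> \<bar>t - y\<bar>" using f by (auto simp: H_class_def)
    also have "\<dots> \<le> \<omega> \<delta> * (1 + (\<bar>t - y\<bar> / \<delta>)\<^sup>2)"
      by (intro modulus_le_quadratic \<omega> \<open>0 < \<delta>\<close>) simp
    finally have "\<bar>f t - f y\<bar> * p t \<le> \<omega> \<delta> * (1 + (\<bar>t - y\<bar> / \<delta>)\<^sup>2) * p t"
      using p(1) by (rule mult_right_mono)
    moreover have "norm ((f t - f y) * p t) = \<bar>f t - f y\<bar> * p t"
      using p(1)[of t] by (simp add: abs_mult)
    ultimately show ?thesis
      by (simp add: W_def power_divide algebra_simps)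
  qed
  have fp: "integrable lborel (\<lambda>t. (f t - f y) * p t)"
    by (rule Bochner_Integration.integrable_bound[OF W_int], measurable)
       (intro AE_I2 order_trans[OF le], simp)
  have "(LINT t|lborel. f t * p t) = (LINT t|lborel. (f t - f y) * p t + f y * p t)"
    by (simp add: algebra_simps)
  also have "\<dots> = (LINT t|lborel. (f t - f y) * p t) + f y"
    using fp p by simp
  finally have "\<bar>(LINT t|lborel. f t * p t) - f y\<bar> = norm (LINT t|lborel. (f t - f y) * p t)"
    by simp
  also have "\<dots> \<le> (LINT t|lborel. norm ((f t - f y) * p t))"
    by (rule integral_norm_bound)
  also have "\<dots> \<le> (LINT t|lborel. W t)"
    by (intro integral_mono integrable_norm fp W_int le)
  also have "\<dots> = \<omega> \<delta> * (1 + (LINT t|lborel. (t - y)\<^sup>2 * p t) / \<delta>\<^sup>2)"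
    unfolding W_def using p p2 by simp
  finally show ?thesis .
qed

section \<open>The two structures as instances of the locales\<close>

lemma probability_density_integral:
  assumes "probability_density p"
  shows "integrable lborel p" "(LINT t|lborel. p t) = 1"
proof -
  have p: "p \<in> borel_measurable borel" "\<And>t. 0 \<le> p t"
    using assms by (auto simp: probability_density_def)
  have "(\<integral>\<^sup>+t. ennreal (p t) \<partial>lborel) = 1"
    using assms p prob_space.emeasure_space_1[of "density lborel (\<lambda>t. ennreal (p t))"]
    by (simp add: probability_density_def emeasure_density)
  then have "has_bochner_integral lborel p 1"
    using p by (intro has_bochner_integral_nn_integral) auto
  then show "integrable lborel p" "(LINT t|lborel. p t) = 1"
    by (auto simp: has_bochner_integral_iff)
qed

lemma structure_B_imp_family:
  assumes "structure_B X \<beta> B" "n \<ge> 1"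
  shows "discrete_exponential_family X \<beta> (B n) (real n)"
proof -
  note B = assms(1)[unfolded structure_B_def]
  show ?thesis
  proof
    show "is_interval X" "\<exists>u\<in>X. \<exists>v\<in>X. u < v" using B by blast+
    show "0 < real n" using assms(2) by simp
    fix x assume x: "x \<in> X"
    show "0 \<le> \<beta> x" using B x by blast
    note Bx = B[THEN conjunct2, THEN conjunct2, THEN conjunct2, rule_format, OF assms(2) x]
    show "0 \<le> B n k x" "B n k x \<le> 1" "(\<lambda>k. B n k x) sums 1" "summable (\<lambda>k. real k ^ m * B n k x)"
      "\<exists>D. (B n k has_real_derivative D) (at x within X) \<and> \<beta> x * D = (real k - real n * x) * B n k x" for k m
      using Bx by blast+
  qed
qed

lemma structure_H_imp_pearson_density:
  assumes H: "structure_H T h K H" "\<And>t. poly h t = a * t\<^sup>2 + b * t + c"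
    and n: "n \<ge> 1" "3 * a < real n" and k: "k \<in> K n"
  shows "pearson_density T (H n k) a b c (real k) (real n)"
proof
  note T = H(1)[unfolded structure_H_def]
  have pd: "probability_density (H n k)"
    using T n(1) k by blast
  show "integrable lborel (H n k)"
    by (rule probability_density_integral[OF pd])
  show "H n k \<in> borel_measurable borel" "0 \<le> H n k t" for t
    using pd by (auto simp: probability_density_def)
  show pos: "0 < a * t\<^sup>2 + b * t + c" if "t \<in> T" for t
    using H that by (auto simp: structure_H_def)
  show "(H n k has_real_derivative (real k - real n * t) * H n k t / (a * t\<^sup>2 + b * t + c)) (at t)"
    if t: "t \<in> T" for t
  proof -
    obtain D where D: "(H n k has_real_derivative D) (at t)" "poly h t * D = (real k - real n * t) * H n k t"
      using T n(1) k t by blast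
    then have "D = (real k - real n * t) * H n k t / (a * t\<^sup>2 + b * t + c)"
      using pos[OF t] by (simp add: H(2) field_simps)
    with D(1) show ?thesis by simp
  qed
  show "is_interval T" "open T" "T \<noteq> {}" using T by blast+
  show "a * t\<^sup>2 + b * t + c = 0" if "t \<in> frontier T" for t
    using T that unfolding H(2) by blast
  show "H n k t = 0" if "t \<notin> closure T" for t
    using T n(1) k that by blast
qed (use n in auto)

section \<open>The estimate for the mixture\<close>

theorem theorem2:
  fixes X T :: "real set" and \<beta> :: "real \<Rightarrow> real" and h :: "real poly"
    and B H :: "nat \<Rightarrow> nat \<Rightarrow> real \<Rightarrow> real" and K :: "nat \<Rightarrow> nat set"
    and a b c :: real and n :: nat and \<omega> f :: "real \<Rightarrow> real"
  assumes "structure_B X \<beta> B"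
    and "structure_H T h K H"
    and "\<forall>t. poly h t = a * t^2 + b * t + c"
    and "n \<ge> 1" and "real n > 3 * a"
    and "\<forall>k. (\<exists>x\<in>X. B n k x \<noteq> 0) \<longrightarrow> k \<in> K n"
    and "modulus_of_continuity \<omega>" and "f \<in> H_class \<omega>"
  shows "\<forall>x\<in>X. \<bar>P_op B H n f x - f x\<bar> \<le>
     \<omega> (1 / sqrt (real n)) *
       (1 + real n / (real n - 3 * a) *
          (a * ((real n * x + b) / (real n - 2 * a))^2
           + b * ((real n * x + b) / (real n - 2 * a)) + c
           + \<beta> x * (real n / (real n - 2 * a))))
     + \<omega> \<bar>(2 * a * x + b) / (real n - 2 * a)\<bar>"
proof
  fix x assume x: "x \<in> X"
  interpret B: discrete_exponential_family X \<beta> "B n" "real n"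
    using assms(1,4) by (rule structure_B_imp_family)
  define d where "d = real n - 2 * a"
  define e where "e = real n - 3 * a"
  have n: "0 < real n" and d: "0 < d" and e: "0 < e"
    using assms(4,5) unfolding d_def e_def by linarith+
  \<comment> \<open>\<open>y\<close> is the mean of the mixture; centring at \<open>y\<close>
    instead of \<open>x\<close> removes the linear term after summation over
    \<open>k\<close>.\<close>
  define y where "y = (real n * x + b) / d"
  define \<delta> where "\<delta> = 1 / sqrt (real n)"
  have \<delta>: "0 < \<delta>" "\<delta>\<^sup>2 = 1 / real n"
    using n by (auto simp: \<delta>_def power_divide)
  have \<omega>_nonneg: "0 \<le> \<omega> \<delta>"
    using assms(7) \<delta>(1) by (simp add: modulus_of_continuity_def)
  define q where "q = a * y\<^sup>2 + b * y + c"
  define q' where "q' = 2 * a * y + b"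
  \<comment> \<open>The second moment of \<open>H n k\<close> about \<open>y\<close>, expanded in
    \<open>real k - real n * x\<close>. The quadratic part contributes \<open>a / e\<close>, the
    shift of the mean contributes 1, and \<open>a + e = d\<close>.\<close>
  define E where "E k = q / e + q' / (d * e) * (real k - real n * x)
      + 1 / (d * e) * (real k - real n * x)\<^sup>2" for k
  define I where "I k = (LINT t|lborel. f t * H n k t)" for k
  \<comment> \<open>Only for \<open>k\<close> of positive mass is \<open>H n k\<close> known to be a
    density; the other terms carry the factor 0.\<close>
  have I_bound: "\<bar>I k - f y\<bar> \<le> \<omega> \<delta> * (1 + real n * E k)" if "B n k x \<noteq> 0" for k
  proof -
    have k: "k \<in> K n" using assms(6) x that by blast
    interpret H: pearson_density T "H n k" a b c "real k" "real n"
      using assms k by (intro structure_H_imp_pearson_density[where h = h and K = K]) auto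
    have one: "(LINT t|lborel. H n k t) = 1"
      using assms(2,4) k by (intro probability_density_integral) (auto simp: structure_H_def)
    define z where "z = (real k - real n * x) / d"
    have m: "(real k + b) / (real n - 2 * a) = y + z"
      using d by (simp add: y_def z_def d_def[symmetric] add_divide_distrib[symmetric])
    have "(LINT t|lborel. (t - y)\<^sup>2 * H n k t) = (a * (y + z)\<^sup>2 + b * (y + z) + c) / e + z\<^sup>2"
      using H.second_moment_about[OF one m[symmetric], of y] by (simp add: e_def)
    also have "\<dots> = (q + q' * z + (a + e) * z\<^sup>2) / e"
      using e by (simp add: q_def q'_def field_simps power2_eq_square)
    also have "a + e = d" by (simp add: d_def e_def)
    also have "(q + q' * z + d * z\<^sup>2) / e = E k"
      using d e by (simp add: E_def z_def field_simps power2_eq_square)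
    finally have "(LINT t|lborel. (t - y)\<^sup>2 * H n k t) = E k" .
    moreover have "integrable lborel (\<lambda>t. (t - y)\<^sup>2 * H n k t)"
      using H.quadratic_integrable[of "y\<^sup>2" "- 2 * y" 1] by (simp add: power2_eq_square algebra_simps)
    ultimately show ?thesis
      using H_class_expectation_bound[OF assms(7,8) \<delta>(1) H.p_nonneg H.p_int one, of y] \<delta>(2)
      by (simp add: I_def mult.commute)
  qed
  obtain V where V: "(\<lambda>k. (real k - real n * x)\<^sup>2 * B n k x) sums V" "V \<le> real n * \<beta> x"
    using B.variance_le[OF x] by blast
  have centred: "(\<lambda>k. (real k - real n * x) * B n k x) sums 0"
    using sums_diff[OF B.mean_sums[OF x] sums_mult[OF B.B_sums[OF x], of "real n * x"]]
    by (simp add: algebra_simps)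
  have "(\<lambda>k. q / e * B n k x + q' / (d * e) * ((real k - real n * x) * B n k x)
      + 1 / (d * e) * ((real k - real n * x)\<^sup>2 * B n k x))
    sums (q / e * 1 + q' / (d * e) * 0 + 1 / (d * e) * V)"
    by (intro sums_add sums_mult B.B_sums[OF x] centred V)
  then have "(\<lambda>k. E k * B n k x) sums (q / e + V / (d * e))"
    by (simp add: E_def algebra_simps)
  from sums_mult[OF sums_add[OF B.B_sums[OF x] sums_mult[OF this, of "real n"]], of "\<omega> \<delta>"]
  have bound_sums: "(\<lambda>k. \<omega> \<delta> * (B n k x + real n * (E k * B n k x)))
      sums (\<omega> \<delta> * (1 + real n * (q / e + V / (d * e))))" .
  \<comment> \<open>Subtracting \<open>f y\<close> first yields terms with a summable majorant.
    Adding it back through the total mass 1 shows that the series in \<open>P_op\<close> converges,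
    so that its value is meaningful.\<close>
  define g where "g k = B n k x * (I k - f y)" for k
  have g_le: "norm (g k) \<le> \<omega> \<delta> * (B n k x + real n * (E k * B n k x))" for k
  proof (cases "B n k x = 0")
    case False
    have "norm (g k) = B n k x * \<bar>I k - f y\<bar>"
      using B.B_nonneg[OF x, of k] by (simp add: g_def abs_mult)
    also have "\<dots> \<le> B n k x * (\<omega> \<delta> * (1 + real n * E k))"
      by (intro mult_left_mono I_bound False B.B_nonneg x)
    finally show ?thesis by (simp add: algebra_simps)
  qed (simp add: g_def)
  have g_summable: "summable g"
    using g_le by (intro summable_comparison_test'[OF sums_summable[OF bound_sums]])
  have "\<bar>suminf g\<bar> \<le> (\<Sum>k. \<omega> \<delta> * (B n k x + real n * (E k * B n k x)))"
    using norm_suminf_le[OF g_le sums_summable[OF bound_sums]] by simp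
  also have "\<dots> = \<omega> \<delta> * (1 + real n * (q / e + V / (d * e)))"
    using bound_sums by (rule sums_unique[symmetric])
  also have "\<dots> \<le> \<omega> \<delta> * (1 + real n * (q / e + real n * \<beta> x / (d * e)))"
    using V(2) d e n \<omega>_nonneg by (intro mult_left_mono add_left_mono divide_right_mono) auto
  also have "real n * (q / e + real n * \<beta> x / (d * e)) = real n / e * (q + \<beta> x * (real n / d))"
    using d e by (simp add: field_simps)
  finally have g_bound: "\<bar>suminf g\<bar> \<le> \<omega> \<delta> * (1 + real n / e * (q + \<beta> x * (real n / d)))" .
  have "(\<lambda>k. g k + f y * B n k x) sums (suminf g + f y * 1)"
    by (intro sums_add sums_mult B.B_sums[OF x] summable_sums g_summable)
  then have "(\<lambda>k. B n k x * I k) sums (suminf g + f y)"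
    by (simp add: g_def algebra_simps)
  then have "P_op B H n f x = suminf g + f y"
    unfolding P_op_def I_def by (rule sums_unique[symmetric])
  moreover have "\<bar>f y - f x\<bar> \<le> \<omega> \<bar>y - x\<bar>"
    using assms(8) by (auto simp: H_class_def)
  moreover have y_x: "y - x = (2 * a * x + b) / d"
    using d by (simp add: y_def field_simps) (simp add: d_def algebra_simps)
  ultimately have "\<bar>P_op B H n f x - f x\<bar>
      \<le> \<omega> \<delta> * (1 + real n / e * (q + \<beta> x * (real n / d))) + \<omega> \<bar>(2 * a * x + b) / d\<bar>"
    using g_bound unfolding y_x by linarith
  then show "\<bar>P_op B H n f x - f x\<bar> \<le>
     \<omega> (1 / sqrt (real n)) *
       (1 + real n / (real n - 3 * a) *
          (a * ((real n * x + b) / (real n - 2 * a))^2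
           + b * ((real n * x + b) / (real n - 2 * a)) + c
           + \<beta> x * (real n / (real n - 2 * a))))
     + \<omega> \<bar>(2 * a * x + b) / (real n - 2 * a)\<bar>"
    unfolding \<delta>_def q_def y_def d_def e_def .
qed

end
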